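(* The prevariety $\mathcal{TBP}_2$ is not finitely based; that is, there is no $m\geq 1$ such that every finite simplicial complex not in $\mathcal{TBP}_2$ has a restriction with at most $m$ vertices that is not in $\mathcal{TBP}_2$.
   Context: A (finite) simplicial complex is a pair $S=(V,\mathcal{H})$ where $V$ is a finite nonempty set and $\mathcal{H}\subseteq 2^V$ contains all singletons and is closed under taking subsets. Its dimension is $\max\{|I|:I\in\mathcal{H}\}-1$. $P_n(V)$ (resp. $P_{\leq n}(V)$) is the set of subsets of $V$ of size exactly (resp. at most) $n$. $S$ is paving if $P_{\dim S}(V)\subseteq\mathcal{H}$. For nonempty $W\subseteq V$ the restriction is $S|_W=(W,\mathcal{H}\cap 2^W)$. $S$ is boolean representable (BRSC) if there is a boolean matrix $M$ with columns indexed by $V$ such that $\mathcal{H}$ is exactly the set of $X\subseteq V$ for which some square submatrix with column set $X$ is congruent (by permuting rows and columns) to a lower unitriangular boolean matrix. For $k\geq 1$, $T_k(S)=(V,\mathcal{H}\cap P_{\leq k}(V))$; $S$ is a TBRSC if $S=T_k(S')$ for some BRSC $S'$ and $k\geq1$. $\mathcal{TBP}_2$ is the class of all finite simplicial complexes of dimension at most $2$ which are paving and TBRSCs; it is closed under isomorphism and restriction (a prevariety). *)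

theory Defs
  imports Main
begin

text \<open>A pair \<open>(V, H)\<close> of a vertex set and a family of faces; being a simplicial complex is
  a predicate.\<close>

type_synonym 'a scomplex = "'a set \<times> 'a set set"

abbreviation verts :: "'a scomplex \<Rightarrow> 'a set" where "verts S \<equiv> fst S"
abbreviation faces :: "'a scomplex \<Rightarrow> 'a set set" where "faces S \<equiv> snd S"

definition simplicial_complex :: "'a scomplex \<Rightarrow> bool" where
  "simplicial_complex S \<longleftrightarrow>
     finite (verts S) \<and> verts S \<noteq> {} \<and> faces S \<subseteq> Pow (verts S) \<and>
     (\<forall>v\<in>verts S. {v} \<in> faces S) \<and>
     (\<forall>I\<in>faces S. \<forall>J. J \<subseteq> I \<longrightarrow> J \<in> faces S)"

text \<open>The truncated subtraction is harmless: a simplicial complex has a face of size 1.\<close>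

definition dimension :: "'a scomplex \<Rightarrow> nat" where
  "dimension S = Max (card ` faces S) - 1"

definition subsets_eq :: "nat \<Rightarrow> 'a set \<Rightarrow> 'a set set" where
  "subsets_eq n V = {X. X \<subseteq> V \<and> card X = n}"

definition subsets_le :: "nat \<Rightarrow> 'a set \<Rightarrow> 'a set set" where
  "subsets_le n V = {X. X \<subseteq> V \<and> card X \<le> n}"

definition paving :: "'a scomplex \<Rightarrow> bool" where
  "paving S \<longleftrightarrow> subsets_eq (dimension S) (verts S) \<subseteq> faces S"

definition restriction :: "'a scomplex \<Rightarrow> 'a set \<Rightarrow> 'a scomplex" where
  "restriction S W = (W, faces S \<inter> Pow W)"

definition lower_unitriangular :: "nat \<Rightarrow> (nat \<Rightarrow> nat \<Rightarrow> bool) \<Rightarrow> bool" where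
  "lower_unitriangular k A \<longleftrightarrow>
     (\<forall>i<k. A i i) \<and> (\<forall>i<k. \<forall>j<k. i < j \<longrightarrow> \<not> A i j)"

text \<open>The submatrix of \<open>M\<close> with row set \<open>R\<close> and column set \<open>X\<close> is square and congruent to a
  lower unitriangular matrix; \<open>r\<close> and \<open>x\<close> are the orderings of its rows and columns obtained by
  permuting them independently.\<close>

definition congruent_unitriangular ::
    "('r \<Rightarrow> 'a \<Rightarrow> bool) \<Rightarrow> 'r set \<Rightarrow> 'a set \<Rightarrow> bool" where
  "congruent_unitriangular M R X \<longleftrightarrow>
     (\<exists>k r x. bij_betw r {..<k} R \<and> bij_betw x {..<k} X \<and>
        lower_unitriangular k (\<lambda>i j. M (r i) (x j)))"

text \<open>A boolean matrix with \<open>n\<close> rows and columns indexed by \<open>verts S\<close> is given by the entries of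
  \<open>M :: nat \<Rightarrow> 'a \<Rightarrow> bool\<close> in the rows \<open>{..<n}\<close> and the columns \<open>verts S\<close>; other values of \<open>M\<close>
  are irrelevant.\<close>

definition boolean_representable :: "'a scomplex \<Rightarrow> bool" where
  "boolean_representable S \<longleftrightarrow>
     (\<exists>(n::nat) (M :: nat \<Rightarrow> 'a \<Rightarrow> bool).
        faces S = {X. X \<subseteq> verts S \<and> (\<exists>R\<subseteq>{..<n}. congruent_unitriangular M R X)})"

definition BRSC :: "'a scomplex set" where
  "BRSC = {S. simplicial_complex S \<and> boolean_representable S}"

definition truncation :: "nat \<Rightarrow> 'a scomplex \<Rightarrow> 'a scomplex" where
  "truncation k S = (verts S, faces S \<inter> subsets_le k (verts S))"

definition TBRSC :: "'a scomplex set" where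
  "TBRSC = {S. \<exists>S'\<in>BRSC. \<exists>k\<ge>1. S = truncation k S'}"

definition TBP2 :: "'a scomplex set" where
  "TBP2 = {S. simplicial_complex S \<and> dimension S \<le> 2 \<and> paving S \<and> S \<in> TBRSC}"

text \<open>Only meaningful over an infinite type \<open>'a\<close>, where every finite simplicial complex has an
  isomorphic copy; over a finite type the bound \<open>m = CARD('a)\<close> always works.\<close>

definition finitely_based :: "'a scomplex set \<Rightarrow> bool" where
  "finitely_based \<V> \<longleftrightarrow>
     (\<exists>m\<ge>1. \<forall>S. simplicial_complex S \<and> S \<notin> \<V> \<longrightarrow>
        (\<exists>W. W \<noteq> {} \<and> W \<subseteq> verts S \<and> card W \<le> m \<and> restriction S W \<notin> \<V>))"

end

(*
  A paving complex of dimension at most 2 is determined by its set N of 3-element non-faces.  Call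
  a set Z closed if it contains every member of N that it meets in at least two vertices.  A row of
  a boolean matrix creates no new face of size 3 exactly if its zero set is closed, and a 3-element
  face needs a row whose zero set contains exactly two of its vertices.  So membership in TBP_2
  means that every 3-element face is separated by a closed set meeting it in exactly two vertices.

  On the vertices 0, ..., 2n let N consist of the triples {2n, i, i+1} for i < n and
  {0, i, i+1} for n <= i < 2n.  These are two fans that share the edge {0, 2n} and
  the vertex n.  Walking along the fans shows that any two of 0, n, 2n generate the third, so the
  face {0, n, 2n} is not separated.  Without a vertex i strictly between 0 and n, the closed set
  {i+1, ..., n, 2n} separates it, and each other face contains a pair that lies in no member of N
  and hence is closed.  So every non-member restriction has at least n - 1 vertices.
*)

theory Submission
  imports Defs
begin

section \<open>Boolean representations by families of zero sets\<close>

text \<open>For \<open>F\<close> the zero sets of matrix rows, these are the column sets of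
  unitriangular submatrices, built from the last column to the first: row \<open>i\<close> is zero
  in all columns after the \<open>i\<close>-th. Intersecting each \<open>Z\<close> with the later
  ones would make these sets a chain.\<close>

inductive chain_transversal :: "'a set set \<Rightarrow> 'a set \<Rightarrow> bool" for F where
  empty: "chain_transversal F {}"
| insert: "chain_transversal F X \<Longrightarrow> Z \<in> F \<Longrightarrow> X \<subseteq> Z \<Longrightarrow> x \<notin> Z \<Longrightarrow> chain_transversal F (insert x X)"

text \<open>Deleting vertices from the insertion order leaves the same sets \<open>Z\<close> as
  witnesses for the remaining insertions.\<close>

lemma chain_transversal_subset:
  assumes "chain_transversal F X" "Y \<subseteq> X"
  shows "chain_transversal F Y"
  using assms
proof (induction arbitrary: Y)
  case empty
  then show ?case by (simp add: chain_transversal.empty)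
next
  case (insert X Z x)
  have "chain_transversal F (Y - {x})"
    using insert.prems by (intro insert.IH) auto
  moreover have "Y - {x} \<subseteq> Z"
    using insert by auto
  ultimately have "chain_transversal F (insert x (Y - {x}))"
    using insert.hyps by (intro chain_transversal.insert)
  then show ?case
    using insert.IH insert.prems by (cases "x \<in> Y") (auto simp: insert_absorb subset_insert)
qed

lemma bij_betw_Suc_split:
  assumes "bij_betw f {..<Suc k} A"
  shows "bij_betw (f \<circ> Suc) {..<k} (A - {f 0})" "f 0 \<in> A"
proof -
  have "inj_on f (insert 0 (Suc ` {..<k}))" and A: "A = insert (f 0) (f ` Suc ` {..<k})"
    using assms unfolding bij_betw_def lessThan_Suc_eq_insert_0 by auto
  then have "inj_on f (Suc ` {..<k})" "f 0 \<notin> f ` Suc ` {..<k}"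
    by (auto simp: inj_on_def)
  with A show "bij_betw (f \<circ> Suc) {..<k} (A - {f 0})" "f 0 \<in> A"
    by (auto simp: bij_betw_def image_comp inj_on_def)
qed

lemma bij_betw_case_nat:
  assumes "bij_betw f {..<k} A" "a \<notin> A"
  shows "bij_betw (case_nat a f) {..<Suc k} (insert a A)"
proof -
  have "inj_on (case_nat a f) (insert 0 (Suc ` {..<k}))"
    using assms by (auto simp: bij_betw_def inj_on_def)
  moreover have "case_nat a f ` insert 0 (Suc ` {..<k}) = insert a A"
    using assms by (auto simp: bij_betw_def image_image)
  ultimately show ?thesis
    by (simp add: bij_betw_def lessThan_Suc_eq_insert_0)
qed

text \<open>The zero set of row \<open>r 0\<close> misses \<open>x 0\<close> and contains all later
  columns, so \<open>x 0\<close> is inserted last; the rest of the submatrix is again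
  unitriangular.\<close>

lemma unitriangular_imp_chain_transversal:
  assumes "bij_betw r {..<k} R" "bij_betw x {..<k} X" "R \<subseteq> I"
    and "lower_unitriangular k (\<lambda>i j. M (r i) (x j))"
  shows "chain_transversal ((\<lambda>i. {v. \<not> M i v}) ` I) X"
  using assms
proof (induction k arbitrary: r R x X)
  case 0
  then show ?case by (simp add: bij_betw_def chain_transversal.empty)
next
  case (Suc k)
  let ?F = "(\<lambda>i. {v. \<not> M i v}) ` I"
  have tri: "M (r 0) (x 0)" "\<And>j. j < k \<Longrightarrow> \<not> M (r 0) (x (Suc j))"
    "lower_unitriangular k (\<lambda>i j. M ((r \<circ> Suc) i) ((x \<circ> Suc) j))"
    using Suc.prems(4) by (auto simp: lower_unitriangular_def)
  note r = bij_betw_Suc_split[OF Suc.prems(1)] and x = bij_betw_Suc_split[OF Suc.prems(2)]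
  have "chain_transversal ?F (X - {x 0})"
    using Suc.prems(3) tri(3) by (intro Suc.IH[OF r(1) x(1)]) auto
  moreover have "{v. \<not> M (r 0) v} \<in> ?F"
    using r(2) Suc.prems(3) by auto
  moreover have "X - {x 0} \<subseteq> {v. \<not> M (r 0) v}"
    using tri(2) by (auto simp flip: bij_betw_imp_surj_on[OF x(1)])
  ultimately have "chain_transversal ?F (insert (x 0) (X - {x 0}))"
    using tri(1) by (intro chain_transversal.insert) auto
  then show ?case
    using x(2) by (simp add: insert_absorb)
qed

lemma chain_transversal_imp_unitriangular:
  assumes "chain_transversal ((\<lambda>i. {v. \<not> M i v}) ` I) X"
  shows "\<exists>R\<subseteq>I. congruent_unitriangular M R X"
  using assms
proof induction
  case empty
  have "congruent_unitriangular M {} {}"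
    unfolding congruent_unitriangular_def
    by (intro exI[of _ 0]) (auto simp: lower_unitriangular_def bij_betw_def)
  then show ?case by blast
next
  case (insert X Z y)
  then obtain R k r x where R: "R \<subseteq> I" "bij_betw r {..<k} R" and x: "bij_betw x {..<k} X"
    and tri: "lower_unitriangular k (\<lambda>i j. M (r i) (x j))"
    unfolding congruent_unitriangular_def by blast
  obtain i where i: "i \<in> I" "Z = {v. \<not> M i v}"
    using insert.hyps by blast
  \<comment> \<open>On \<open>X\<close> row \<open>i\<close> is zero, while each row of
    \<open>R\<close> has its diagonal one there; so \<open>i\<close> is a new row and can be placed
    first.\<close>
  have "M (r j) (x j)" "\<not> M i (x j)" if "j < k" for j
    using that tri x i insert.hyps by (auto simp: lower_unitriangular_def bij_betw_def)
  then have "i \<notin> R"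
    using R(2) by (auto simp: bij_betw_def)
  moreover have "y \<notin> X"
    using insert.hyps by auto
  moreover have "lower_unitriangular (Suc k) (\<lambda>a b. M (case_nat i r a) (case_nat y x b))"
    using tri \<open>\<And>j. j < k \<Longrightarrow> \<not> M i (x j)\<close> insert.hyps i
    by (auto simp: lower_unitriangular_def split: nat.split)
  ultimately have "congruent_unitriangular M (insert i R) (insert y X)"
    using bij_betw_case_nat[OF R(2)] bij_betw_case_nat[OF x]
    unfolding congruent_unitriangular_def by blast
  then show ?case
    using R(1) i(1) by (intro exI[of _ "insert i R"]) auto
qed

lemma congruent_unitriangular_iff:
  "(\<exists>R\<subseteq>I. congruent_unitriangular M R X) \<longleftrightarrow> chain_transversal ((\<lambda>i. {v. \<not> M i v}) ` I) X"
  using chain_transversal_imp_unitriangular[of M I X]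
  by (auto simp: congruent_unitriangular_def intro: unitriangular_imp_chain_transversal)

text \<open>Only the zero sets of the rows matter. Conversely, an enumeration of a finite
  \<open>F\<close> gives rows with ones exactly outside its members.\<close>

lemma boolean_representable_iff:
  "boolean_representable S \<longleftrightarrow>
     (\<exists>F. finite F \<and> faces S = {X. X \<subseteq> verts S \<and> chain_transversal F X})"
proof
  assume "boolean_representable S"
  then obtain n M where
    "faces S = {X. X \<subseteq> verts S \<and> chain_transversal ((\<lambda>i::nat. {v. \<not> M i v}) ` {..<n}) X}"
    unfolding boolean_representable_def congruent_unitriangular_iff by blast
  then show "\<exists>F. finite F \<and> faces S = {X. X \<subseteq> verts S \<and> chain_transversal F X}"
    by (intro exI[of _ "(\<lambda>i::nat. {v. \<not> M i v}) ` {..<n}"]) simp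
next
  assume "\<exists>F. finite F \<and> faces S = {X. X \<subseteq> verts S \<and> chain_transversal F X}"
  then obtain F where F: "finite F" "faces S = {X. X \<subseteq> verts S \<and> chain_transversal F X}"
    by blast
  obtain n and f :: "nat \<Rightarrow> 'a set" where "F = f ` {i. i < n}"
    using finite_imp_nat_seg_image_inj_on[OF F(1)] by blast
  then have "F = (\<lambda>i. {v. \<not> v \<notin> f i}) ` {..<n}"
    by (simp add: lessThan_def)
  with F(2) show "boolean_representable S"
    unfolding boolean_representable_def congruent_unitriangular_iff
    by (intro exI[of _ n] exI[of _ "\<lambda>i v. v \<notin> f i"]) simp
qed

section \<open>Complexes given by their 3-element non-faces\<close>

text \<open>\<open>N\<close> may also contain sets outside \<open>V\<close>; thus a restriction
  changes \<open>V\<close> and keeps \<open>N\<close>.\<close>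

definition triple_complex :: "'a set \<Rightarrow> 'a set set \<Rightarrow> 'a scomplex" where
  "triple_complex V N = (V, {X. X \<subseteq> V \<and> card X \<le> 3 \<and> X \<notin> N})"

definition triple_closed :: "'a set \<Rightarrow> 'a set set \<Rightarrow> 'a set \<Rightarrow> bool" where
  "triple_closed V N Z \<longleftrightarrow> (\<forall>T\<in>N. T \<subseteq> V \<longrightarrow> 2 \<le> card (T \<inter> Z) \<longrightarrow> T \<subseteq> Z)"

definition separated :: "'a set \<Rightarrow> 'a set set \<Rightarrow> bool" where
  "separated V N \<longleftrightarrow>
     (\<forall>X. X \<subseteq> V \<longrightarrow> card X = 3 \<longrightarrow> X \<notin> N \<longrightarrow> (\<exists>Z. triple_closed V N Z \<and> card (X \<inter> Z) = 2))"

lemma restriction_triple_complex: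
  "W \<subseteq> V \<Longrightarrow> restriction (triple_complex V N) W = triple_complex W N"
  by (auto simp: restriction_def triple_complex_def)

text \<open>A proper subset of a face has fewer than three elements, so it is not in
  \<open>N\<close>.\<close>

lemma simplicial_complex_triple_complex:
  assumes "finite V" "V \<noteq> {}" and N: "\<And>T. T \<in> N \<Longrightarrow> card T = 3"
  shows "simplicial_complex (triple_complex V N)"
proof -
  have down: "J \<in> faces (triple_complex V N)" if I: "I \<in> faces (triple_complex V N)" and "J \<subseteq> I" for I J
  proof -
    have "finite I"
      using I assms(1) by (auto simp: triple_complex_def intro: finite_subset)
    then have "card J \<le> card I" "card J = card I \<Longrightarrow> J = I"
      using card_mono[OF \<open>finite I\<close> \<open>J \<subseteq> I\<close>] card_subset_eq[OF \<open>finite I\<close> \<open>J \<subseteq> I\<close>] by auto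
    then show ?thesis
      using I \<open>J \<subseteq> I\<close> N[of J] by (auto simp: triple_complex_def)
  qed
  have "{v} \<notin> N" for v
    using N[of "{v}"] by auto
  then have "finite (verts (triple_complex V N))" "verts (triple_complex V N) \<noteq> {}"
    "faces (triple_complex V N) \<subseteq> Pow (verts (triple_complex V N))"
    "\<forall>v\<in>verts (triple_complex V N). {v} \<in> faces (triple_complex V N)"
    using assms(1,2) by (auto simp: triple_complex_def)
  then show ?thesis
    unfolding simplicial_complex_def using down by blast
qed

lemma dimension_triple_complex:
  assumes "finite V" and N: "\<And>T. T \<in> N \<Longrightarrow> card T = 3"
  shows "dimension (triple_complex V N) \<le> 2"
proof -
  have "{} \<in> faces (triple_complex V N)"
    using N[of "{}"] by (auto simp: triple_complex_def)
  moreover have "finite (faces (triple_complex V N))"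
    using assms(1) by (auto simp: triple_complex_def intro: finite_subset[of _ "Pow V"])
  ultimately have "Max (card ` faces (triple_complex V N)) \<le> 3"
    by (subst Max_le_iff) (auto simp: triple_complex_def intro: exI[of _ "{}"])
  then show ?thesis
    by (simp add: dimension_def)
qed

lemma paving_triple_complex:
  assumes "finite V" and N: "\<And>T. T \<in> N \<Longrightarrow> card T = 3"
  shows "paving (triple_complex V N)"
  using dimension_triple_complex[OF assms] N
  by (fastforce simp: paving_def subsets_eq_def triple_complex_def)

text \<open>The zero sets of a representation are the separating sets: two vertices always form a
  face, so a zero set containing just two vertices of a member of \<open>N\<close> would allow the
  third to be inserted. The last insertion into a 3-element face gives its separating set.\<close>

lemma triple_complex_TBRSC_imp_separated:
  assumes fin: "finite V" and N: "\<And>T. T \<in> N \<Longrightarrow> card T = 3"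
    and T: "triple_complex V N \<in> TBRSC"
  shows "separated V N"
proof -
  obtain S k where S: "S \<in> BRSC" and trunc: "triple_complex V N = truncation k S"
    using T by (auto simp: TBRSC_def)
  have verts: "verts S = V"
    using trunc by (simp add: triple_complex_def truncation_def)
  obtain F where F: "faces S = {X. X \<subseteq> V \<and> chain_transversal F X}"
    using S verts by (auto simp: BRSC_def boolean_representable_iff)
  have face: "X \<notin> N \<longleftrightarrow> chain_transversal F X \<and> card X \<le> k" if "X \<subseteq> V" "card X \<le> 3" for X
    using arg_cong[OF trunc, of "\<lambda>K. X \<in> faces K"] that
    by (simp add: triple_complex_def truncation_def subsets_le_def F verts)
  \<comment> \<open>For \<open>k < 3\<close> the truncation itself removes all triples, so a missing
    triple says nothing about \<open>F\<close>. A face of size 3 later supplies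
    \<open>3 \<le> k\<close>.\<close>
  have closed: "triple_closed V N Z" if "Z \<in> F" "3 \<le> k" for Z
    unfolding triple_closed_def
  proof (intro ballI impI)
    fix T assume T: "T \<in> N" "T \<subseteq> V" "2 \<le> card (T \<inter> Z)"
    show "T \<subseteq> Z"
    proof (rule ccontr)
      assume "\<not> T \<subseteq> Z"
      then obtain x where x: "x \<in> T" "x \<notin> Z" by blast
      have "finite T"
        using T(2) fin finite_subset by blast
      have "T \<inter> Z \<subseteq> T - {x}" "card (T - {x}) = 2"
        using x N[OF T(1)] by auto
      then have TZ: "T \<inter> Z = T - {x}"
        using T(3) \<open>finite T\<close> by (intro card_seteq) auto
      have "T - {x} \<notin> N"
        using N[of "T - {x}"] \<open>card (T - {x}) = 2\<close> by auto
      then have "chain_transversal F (T - {x})"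
        using face[of "T - {x}"] T(2) \<open>card (T - {x}) = 2\<close> by auto
      then have "chain_transversal F (insert x (T - {x}))"
        using TZ x that(1) by (intro chain_transversal.insert[of F _ Z]) auto
      then show False
        using face[of T] T N[OF T(1)] x that(2) by (simp add: insert_absorb)
    qed
  qed
  have "\<exists>Z. triple_closed V N Z \<and> card (X \<inter> Z) = 2"
    if X: "X \<subseteq> V" "card X = 3" "X \<notin> N" for X
  proof -
    have "chain_transversal F X" "3 \<le> k"
      using face[of X] X by auto
    then obtain Y Z x where Z: "X = insert x Y" "Z \<in> F" "Y \<subseteq> Z" "x \<notin> Z"
      using X(2) by (cases rule: chain_transversal.cases) auto
    have "X \<inter> Z = X - {x}"
      using Z by auto
    moreover have "x \<in> X"
      using Z(1) by simp
    ultimately have "card (X \<inter> Z) = 2"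
      using X(2) by (simp add: card_Diff_singleton)
    then show ?thesis
      using closed[OF Z(2) \<open>3 \<le> k\<close>] by auto
  qed
  then show ?thesis
    by (auto simp: separated_def)
qed

text \<open>Covers at once the empty set, the singletons (\<open>x = y\<close>) and the pairs that
  lie in no member of \<open>N\<close> inside \<open>V\<close>.\<close>

lemma triple_closed_subset_doubleton:
  assumes "Z \<subseteq> {x, y}" "\<And>T. T \<in> N \<Longrightarrow> T \<subseteq> V \<Longrightarrow> \<not> {x, y} \<subseteq> T \<or> x = y"
  shows "triple_closed V N Z"
  unfolding triple_closed_def
proof (intro ballI impI)
  fix T assume T: "T \<in> N" "T \<subseteq> V" "2 \<le> card (T \<inter> Z)"
  have "card {x, y} \<le> 2"
    by (simp add: card_insert_if)
  then have "T \<inter> Z = {x, y}"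
    using T(3) assms(1) by (intro card_seteq) auto
  then have "x \<noteq> y" "{x, y} \<subseteq> T"
    using T(3) by auto
  then show "T \<subseteq> Z"
    using assms(2) T by blast
qed

text \<open>The empty set serves for inserting the first vertex, the singleton of that vertex for
  inserting a second.\<close>

lemma chain_transversal_le_2:
  assumes F: "{} \<in> F" "\<And>v. v \<in> X \<Longrightarrow> {v} \<in> F" and X: "finite X" "card X \<le> 2"
  shows "chain_transversal F X"
proof -
  have empty: "chain_transversal F {}"
    by (rule chain_transversal.empty)
  have single: "chain_transversal F {v}" for v
    using chain_transversal.insert[OF empty F(1), of v] by simp
  consider "card X = 0" | "card X = 1" | "card X = 2"
    using X(2) by linarith
  then show ?thesis
  proof cases
    case 3
    then obtain x y where xy: "X = {x, y}" "x \<noteq> y"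
      by (auto simp: card_2_iff)
    then show ?thesis
      using chain_transversal.insert[OF single F(2)[of y], of y x] by auto
  qed (use X(1) empty single in \<open>auto simp: card_1_singleton_iff\<close>)
qed

text \<open>All closed subsets of \<open>V\<close> serve as zero sets. Their chain transversals can
  have more than three elements; truncating at 3 removes these.\<close>

lemma separated_imp_triple_complex_TBRSC:
  assumes fin: "finite V" and ne: "V \<noteq> {}" and N: "\<And>T. T \<in> N \<Longrightarrow> card T = 3"
    and sep: "separated V N"
  shows "triple_complex V N \<in> TBRSC"
proof -
  define F where "F = {Z. Z \<subseteq> V \<and> triple_closed V N Z}"
  define S where "S = (V, {X. X \<subseteq> V \<and> chain_transversal F X})"
  \<comment> \<open>With \<open>x = y\<close> the condition on \<open>N\<close> is trivially true,
    so any value, here \<open>undefined\<close>, serves for the empty set.\<close>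
  have small: "{} \<in> F" "\<And>v. v \<in> V \<Longrightarrow> {v} \<in> F"
    using triple_closed_subset_doubleton[of "{}" undefined undefined N V]
      triple_closed_subset_doubleton[of "{v}" v v N V for v]
    by (auto simp: F_def)
  have le2: "chain_transversal F X" if "X \<subseteq> V" "card X \<le> 2" for X
    using that small finite_subset[OF that(1) fin] by (intro chain_transversal_le_2) auto
  have "finite F"
    using fin by (auto simp: F_def intro: finite_subset[of _ "Pow V"])
  then have "boolean_representable S"
    by (auto simp: boolean_representable_iff S_def)
  moreover have "simplicial_complex S"
    using fin ne le2 by (auto simp: simplicial_complex_def S_def intro: chain_transversal_subset)
  ultimately have "S \<in> BRSC"
    by (simp add: BRSC_def)
  have "X \<notin> N \<longleftrightarrow> chain_transversal F X" if X: "X \<subseteq> V" "card X \<le> 3" for X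
  proof (cases "card X = 3")
    case False
    then show ?thesis
      using X le2[of X] N[of X] by auto
  next
    case True
    have "finite X"
      using X(1) fin finite_subset by blast
    show ?thesis
    proof
      assume "X \<notin> N"
      then obtain Z where Z: "triple_closed V N Z" "card (X \<inter> Z) = 2"
        using sep X(1) True by (auto simp: separated_def)
      \<comment> \<open>Only triples inside \<open>V\<close> count for closedness, so
        \<open>Z\<close> may be cut down to \<open>V\<close>.\<close>
      have "triple_closed V N (V \<inter> Z)"
        using Z(1) unfolding triple_closed_def by (metis Int_assoc inf.absorb1 le_inf_iff)
      then have "V \<inter> Z \<in> F"
        by (simp add: F_def)
      have "card (X - Z) = 1"
        using True Z(2) \<open>finite X\<close> by (simp add: card_Diff_subset_Int)
      then obtain x where x: "X - Z = {x}"
        by (auto simp: card_1_singleton_iff)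
      have "chain_transversal F (X \<inter> Z)"
        using Z(2) X(1) by (intro le2) auto
      then have "chain_transversal F (insert x (X \<inter> Z))"
        using \<open>V \<inter> Z \<in> F\<close> by (rule chain_transversal.insert) (use x X in auto)
      moreover have "insert x (X \<inter> Z) = X"
        using x by auto
      ultimately show "chain_transversal F X"
        by simp
    next
      assume "chain_transversal F X"
      then obtain Y Z x where Z: "X = insert x Y" "Z \<in> F" "Y \<subseteq> Z" "x \<notin> Z"
        using True by (cases rule: chain_transversal.cases) auto
      \<comment> \<open>The zero set of the last insertion meets \<open>X\<close> in exactly two
        vertices; being closed, it excludes \<open>X\<close> from \<open>N\<close>.\<close>
      have "X \<inter> Z = X - {x}"
        using Z by auto
      moreover have "x \<in> X"
        using Z(1) by simp
      ultimately have "card (X \<inter> Z) = 2"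
        using True by (simp add: card_Diff_singleton)
      then show "X \<notin> N"
        using Z X(1) by (auto simp: F_def triple_closed_def)
    qed
  qed
  then have "triple_complex V N = truncation 3 S"
    by (auto simp: triple_complex_def truncation_def subsets_le_def S_def)
  then show ?thesis
    using \<open>S \<in> BRSC\<close> unfolding TBRSC_def by (intro CollectI bexI exI[of _ 3]) auto
qed

lemma triple_complex_TBP2_iff:
  assumes "finite V" "V \<noteq> {}" "\<And>T. T \<in> N \<Longrightarrow> card T = 3"
  shows "triple_complex V N \<in> TBP2 \<longleftrightarrow> separated V N"
  using assms simplicial_complex_triple_complex[OF assms] dimension_triple_complex[of V N]
    paving_triple_complex[of V N] triple_complex_TBRSC_imp_separated[of V N]
    separated_imp_triple_complex_TBRSC[of V N]
  by (auto simp: TBP2_def)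

section \<open>Transport along an injection\<close>

lemma triple_closed_image:
  assumes "inj f"
  shows "triple_closed (f ` V) ((`) f ` N) Z \<longleftrightarrow> triple_closed V N (f -` Z)"
proof -
  have "card (f ` T \<inter> Z) = card (T \<inter> f -` Z)" for T
  proof -
    have "f ` T \<inter> Z = f ` (T \<inter> f -` Z)" by auto
    then show ?thesis
      using assms by (metis card_image inj_on_subset subset_UNIV)
  qed
  moreover have "f ` T \<subseteq> f ` V \<longleftrightarrow> T \<subseteq> V" for T
    using assms by (simp add: inj_image_subset_iff)
  ultimately show ?thesis
    by (auto simp: triple_closed_def image_subset_iff_subset_vimage)
qed

text \<open>Carries the fans, built on natural numbers, over to an arbitrary infinite vertex type.
  Closed sets are pulled back by preimage and pushed forward by image.\<close>

lemma separated_image: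
  fixes f :: "'b \<Rightarrow> 'a"
  assumes "inj f"
  shows "separated (f ` V) ((`) f ` N) \<longleftrightarrow> separated V N"
proof -
  have card: "card (f ` X) = card X" for X
    using assms by (metis card_image inj_on_subset subset_UNIV)
  have mem: "f ` X \<in> (`) f ` N \<longleftrightarrow> X \<in> N" for X
    using assms by (auto simp: inj_image_eq_iff)
  have Z: "(\<exists>Z. triple_closed (f ` V) ((`) f ` N) Z \<and> card (f ` X \<inter> Z) = 2) \<longleftrightarrow>
      (\<exists>Z. triple_closed V N Z \<and> card (X \<inter> Z) = 2)" (is "?L \<longleftrightarrow> ?R") for X
  proof
    assume ?L
    then obtain Z where Z: "triple_closed V N (f -` Z)" "card (f ` X \<inter> Z) = 2"
      using triple_closed_image[OF assms] by blast
    moreover have "f ` X \<inter> Z = f ` (X \<inter> f -` Z)"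
      by auto
    ultimately show ?R
      using card by metis
  next
    assume ?R
    then obtain Z where Z: "triple_closed V N Z" "card (X \<inter> Z) = 2"
      by blast
    have "f -` f ` Z = Z" "f ` X \<inter> f ` Z = f ` (X \<inter> Z)"
      using assms by (auto simp: inj_vimage_image_eq image_Int)
    then show ?L
      using Z card triple_closed_image[OF assms, of V N "f ` Z"] by metis
  qed
  show ?thesis
    unfolding separated_def all_subset_image by (simp add: Z card mem)
qed

section \<open>The two fans\<close>

definition fans :: "nat \<Rightarrow> nat set set" where
  "fans n = (\<lambda>i. {2 * n, i, Suc i}) ` {..<n} \<union> (\<lambda>i. {0, i, Suc i}) ` {n..<2 * n}"

lemma card_fans: "1 \<le> n \<Longrightarrow> T \<in> fans n \<Longrightarrow> card T = 3"
  by (auto simp: fans_def)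

lemma triple_closed_step:
  assumes "triple_closed V N Z" "{x, y, z} \<in> N" "{x, y, z} \<subseteq> V" "x \<noteq> y" "x \<in> Z" "y \<in> Z"
  shows "z \<in> Z"
proof -
  have "{x, y} \<subseteq> {x, y, z} \<inter> Z" "card {x, y} = 2"
    using assms by auto
  then have "2 \<le> card ({x, y, z} \<inter> Z)"
    by (metis card_mono finite.emptyI finite.insertI finite_Int)
  then have "{x, y, z} \<subseteq> Z"
    using assms(1-3) unfolding triple_closed_def by blast
  then show ?thesis
    by simp
qed

lemma fans_not_separated:
  assumes "2 \<le> n"
  shows "\<not> separated {..2 * n} (fans n)"
proof
  assume sep: "separated {..2 * n} (fans n)"
  \<comment> \<open>Each fan triple contains two consecutive numbers, but no two of 0,
    \<open>n\<close>, \<open>2 * n\<close> are consecutive for \<open>n \<ge> 2\<close>.\<close>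
  have "T \<noteq> {0, n, 2 * n}" if T: "T \<in> fans n" for T
  proof -
    have no_step: "\<not> {i, Suc i} \<subseteq> {0, n, 2 * n}" if "i < 2 * n" for i
      using assms that by auto
    consider i where "T = {2 * n, i, Suc i}" "i < n" | i where "T = {0, i, Suc i}" "i < 2 * n"
      using T by (auto simp: fans_def)
    then obtain i where "i < 2 * n" "{i, Suc i} \<subseteq> T"
    proof cases
      case (1 i)
      then show ?thesis using that[of i] by simp
    next
      case (2 i)
      then show ?thesis using that[of i] by simp
    qed
    then show ?thesis
      using no_step by meson
  qed
  then have "{0, n, 2 * n} \<notin> fans n"
    by blast
  moreover have card3: "card {0, n, 2 * n} = 3" and "{0, n, 2 * n} \<subseteq> {..2 * n}"
    using assms by auto
  ultimately obtain Z where Z: "triple_closed {..2 * n} (fans n) Z" "card ({0, n, 2 * n} \<inter> Z) = 2"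
    using sep unfolding separated_def by meson
  have fan1: "{2 * n, i, Suc i} \<in> fans n" if "i < n" for i
    using that by (auto simp: fans_def)
  have fan2: "{0, i, Suc i} \<in> fans n" if "n \<le> i" "i < 2 * n" for i
    using that by (auto simp: fans_def)
  \<comment> \<open>The first fan has apex \<open>2 * n\<close>; the walk climbs its path from 0 to
    \<open>n\<close>.\<close>
  have up1: "n \<in> Z" if "2 * n \<in> Z" "0 \<in> Z"
  proof -
    have "i \<le> n \<Longrightarrow> i \<in> Z" for i
    proof (induction i)
      case (Suc i)
      then show ?case
        using triple_closed_step[OF Z(1) fan1[of i]] that by auto
    qed (use that in simp)
    then show ?thesis by simp
  qed
  have down1: "0 \<in> Z" if "2 * n \<in> Z" "n \<in> Z"
  proof -
    \<comment> \<open>The same path downwards. From \<open>i = n\<close> on, truncated subtraction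
      leaves the vertex at 0.\<close>
    have "n - i \<in> Z" for i
    proof (induction i)
      case (Suc i)
      show ?case
      proof (cases "i < n")
        case True
        then have "{2 * n, n - i, n - Suc i} \<in> fans n"
          using fan1[of "n - Suc i"] by (simp add: Suc_diff_Suc insert_commute)
        moreover have "2 * n \<noteq> n - i" "{2 * n, n - i, n - Suc i} \<subseteq> {..2 * n}"
          using assms by auto
        ultimately show ?thesis
          using triple_closed_step[OF Z(1)] that Suc by meson
      qed (use Suc in simp)
    qed (use that in simp)
    from this[of n] show ?thesis by simp
  qed
  \<comment> \<open>The second fan has apex 0, and its path leads from \<open>n\<close> to
    \<open>2 * n\<close>.\<close>
  have up2: "2 * n \<in> Z" if "0 \<in> Z" "n \<in> Z"
  proof -
    have "i \<le> n \<Longrightarrow> n + i \<in> Z" for i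
    proof (induction i)
      case (Suc i)
      then show ?case
        using triple_closed_step[OF Z(1) fan2[of "n + i"]] that assms by auto
    qed (use that in simp)
    from this[of n] show ?thesis by (simp add: mult_2)
  qed
  obtain u v where uv: "{0, n, 2 * n} \<inter> Z = {u, v}" "u \<noteq> v"
    using Z(2) by (auto simp only: card_2_iff)
  then have "u \<in> {0, n, 2 * n}" "v \<in> {0, n, 2 * n}" "u \<in> Z" "v \<in> Z"
    by blast+
  \<comment> \<open>Whichever two of 0, \<open>n\<close>, \<open>2 * n\<close> the vertices
    \<open>u\<close> and \<open>v\<close> are, one of the three walks yields the third.\<close>
  then have "0 \<in> Z \<and> n \<in> Z \<and> 2 * n \<in> Z"
    using uv(2) up1 down1 up2 by (elim insertE emptyE) metis+
  then have "{0, n, 2 * n} \<inter> Z = {0, n, 2 * n}"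
    by blast
  then show False
    using Z(2) card3 by simp
qed

text \<open>The pairs covered by the fans form a graph whose only triangle outside \<open>fans n\<close> is
  \<open>{0, n, 2 * n}\<close>.\<close>

lemma fans_uncovered_pair:
  assumes n: "3 \<le> n" and xyz: "x < y" "y < z" "z \<le> 2 * n"
    and X: "{x, y, z} \<notin> fans n" "{x, y, z} \<noteq> {0, n, 2 * n}"
  shows "\<exists>u\<in>{x, y, z}. \<exists>v\<in>{x, y, z}. u \<noteq> v \<and> (\<forall>T\<in>fans n. \<not> {u, v} \<subseteq> T)"
proof (rule ccontr)
  assume neg: "\<not> ?thesis"
  \<comment> \<open>The alternatives are: apex and path vertex of the first fan, consecutive
    vertices, apex and path vertex of the second fan.\<close>
  have pair: "v = 2 * n \<and> u \<le> n \<or> v = Suc u \<or> u = 0 \<and> n \<le> v"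
    if uv: "u \<in> {x, y, z}" "v \<in> {x, y, z}" "u < v" for u v
  proof -
    obtain T where "T \<in> fans n" "u \<in> T" "v \<in> T"
      using neg uv by (metis insert_subset less_irrefl)
    then show ?thesis
      using uv(3) by (auto simp: fans_def)
  qed
  have "y = 2 * n \<and> x \<le> n \<or> y = Suc x \<or> x = 0 \<and> n \<le> y"
    "z = 2 * n \<and> y \<le> n \<or> z = Suc y \<or> y = 0 \<and> n \<le> z"
    "z = 2 * n \<and> x \<le> n \<or> z = Suc x \<or> x = 0 \<and> n \<le> z"
    using xyz by (intro pair; simp)+
  \<comment> \<open>Three consecutive numbers are ruled out by \<open>3 \<le> n\<close>; for
    \<open>n = 2\<close> the triple 0, 1, 2 would be a further triangle. The first two cases are fan
    triples, the third is the exceptional triangle.\<close>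
  then consider "z = 2 * n" "y = Suc x" "x < n" | "x = 0" "z = Suc y" "n \<le> y" "y < 2 * n"
    | "x = 0" "y = n" "z = 2 * n"
    using n xyz by linarith
  then show False
    using X by cases (auto simp: fans_def insert_commute)
qed

lemma fans_restricted_separated:
  assumes n: "3 \<le> n" and U: "U \<subseteq> {..2 * n}" and k: "0 < k" "k < n" "k \<notin> U"
  shows "separated U (fans n)"
  unfolding separated_def
proof (intro allI impI)
  fix X assume X: "X \<subseteq> U" "card X = 3" "X \<notin> fans n"
  show "\<exists>Z. triple_closed U (fans n) Z \<and> card (X \<inter> Z) = 2"
  proof (cases "X = {0, n, 2 * n}")
    case True
    \<comment> \<open>Started from \<open>n\<close> and \<open>2 * n\<close>, a walk down the first
      fan cannot pass the missing vertex \<open>k\<close>; \<open>?Z\<close> holds all vertices it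
      could reach.\<close>
    let ?Z = "insert (2 * n) {k<..n}"
    have "T \<subseteq> ?Z" if T: "T \<in> fans n" "T \<subseteq> U" "2 \<le> card (T \<inter> ?Z)" for T
    proof -
      obtain u v where uv: "u \<in> T \<inter> ?Z" "v \<in> T \<inter> ?Z" "u \<noteq> v"
        using T(3) by (metis One_nat_def Suc_1 card_le_Suc0_iff_eq card.infinite not_less_eq_eq zero_le)
      consider i where "T = {2 * n, i, Suc i}" "i < n" | i where "T = {0, i, Suc i}" "n \<le> i" "i < 2 * n"
        using T(1) by (auto simp: fans_def)
      then show ?thesis
      proof cases
        case 1
        \<comment> \<open>At least one of \<open>i\<close> and \<open>Suc i\<close> exceeds
          \<open>k\<close>; as neither equals \<open>k\<close>, both do.\<close>
        then have "k \<noteq> i" "k \<noteq> Suc i"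
          using T(2) k(3) by auto
        moreover have "k < Suc i"
          using uv 1 by auto
        ultimately show ?thesis
          using 1 by auto
      next
        case 2
        \<comment> \<open>Since 0 is not in \<open>?Z\<close>, both path vertices would be; but from
          \<open>n\<close> on \<open>?Z\<close> contains only \<open>n\<close> and
          \<open>2 * n\<close>, which are not consecutive, so this case is impossible.\<close>
        then have "{i, Suc i} \<subseteq> ?Z"
          using uv n by auto
        then show ?thesis
          using 2 n by auto
      qed
    qed
    then have "triple_closed U (fans n) ?Z"
      by (simp add: triple_closed_def)
    moreover have "X \<inter> ?Z = {n, 2 * n}"
      using True n k by auto
    ultimately show ?thesis
      using n by (intro exI[of _ ?Z]) auto
  next
    case False
    obtain x y z where X_eq: "X = {x, y, z}" and "x < y" "y < z"
    proof -
      obtain a b c where "X = {a, b, c}" "a \<noteq> b" "a \<noteq> c" "b \<noteq> c"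
        using X(2) by (auto simp: card_3_iff)
      then show ?thesis
        using that[of a b c] that[of a c b] that[of b a c] that[of b c a] that[of c a b] that[of c b a]
        by (auto simp: insert_commute neq_iff)
    qed
    moreover have "z \<le> 2 * n"
      using X_eq X(1) U by auto
    ultimately have "\<exists>u\<in>X. \<exists>v\<in>X. u \<noteq> v \<and> (\<forall>T\<in>fans n. \<not> {u, v} \<subseteq> T)"
      using X(3) False unfolding X_eq by (intro fans_uncovered_pair[OF n])
    then obtain u v where uv: "u \<in> X" "v \<in> X" "u \<noteq> v" "\<forall>T\<in>fans n. \<not> {u, v} \<subseteq> T"
      by blast
    then have "triple_closed U (fans n) {u, v}"
      by (intro triple_closed_subset_doubleton[of _ u v]) auto
    moreover have "X \<inter> {u, v} = {u, v}"
      using uv by auto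
    ultimately show ?thesis
      using uv(3) by (intro exI[of _ "{u, v}"]) auto
  qed
qed

theorem theorem6p4:
  assumes "infinite (UNIV :: 'a set)"
  shows "\<not> finitely_based (TBP2 :: 'a scomplex set)"
proof
  assume "finitely_based (TBP2 :: 'a scomplex set)"
  then obtain m where m: "m \<ge> 1" and base: "\<And>S :: 'a scomplex. simplicial_complex S \<Longrightarrow> S \<notin> TBP2 \<Longrightarrow>
      \<exists>W. W \<noteq> {} \<and> W \<subseteq> verts S \<and> card W \<le> m \<and> restriction S W \<notin> TBP2"
    unfolding finitely_based_def by blast
  obtain f :: "nat \<Rightarrow> 'a" where f: "inj f"
    using infinite_countable_subset[OF assms] by blast
  \<comment> \<open>The interval \<open>{0<..<n}\<close> then has \<open>m + 1\<close> elements, so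
    a set \<open>U\<close> of at most \<open>m\<close> vertices misses one of them; and
    \<open>m \<ge> 1\<close> gives \<open>3 \<le> n\<close>.\<close>
  define n where "n = m + 2"
  define N where "N = (`) f ` fans n"
  define S where "S = triple_complex (f ` {..2 * n}) N"
  have n: "3 \<le> n"
    using m by (simp add: n_def)
  have card_N: "card T = 3" if "T \<in> N" for T
    using that card_fans[of n] n f by (auto simp: N_def card_image inj_on_subset)
  have iff: "triple_complex (f ` U) N \<in> TBP2 \<longleftrightarrow> separated U (fans n)" if "finite U" "U \<noteq> {}" for U
    using triple_complex_TBP2_iff[of "f ` U" N] that card_N separated_image[OF f]
    by (simp add: N_def)
  have "simplicial_complex S"
    unfolding S_def by (intro simplicial_complex_triple_complex card_N) auto
  moreover have "S \<notin> TBP2"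
    using iff[of "{..2 * n}"] fans_not_separated[of n] n by (auto simp: S_def)
  ultimately obtain W where W: "W \<noteq> {}" "W \<subseteq> verts S" "card W \<le> m" "restriction S W \<notin> TBP2"
    using base by blast
  have "W \<subseteq> f ` {..2 * n}"
    using W(2) by (simp add: S_def triple_complex_def)
  then obtain U where U: "U \<subseteq> {..2 * n}" "W = f ` U"
    by (auto simp: subset_image_iff)
  have "finite U"
    using U(1) finite_subset by blast
  have "card U \<le> m"
    using W(3) U(2) f by (metis card_image inj_on_subset subset_UNIV)
  then have "\<not> {0<..<n} \<subseteq> U"
    using card_mono[OF \<open>finite U\<close>, of "{0<..<n}"] by (auto simp: n_def)
  then obtain k where "0 < k" "k < n" "k \<notin> U"
    by (meson greaterThanLessThan_iff subsetI)
  then have "separated U (fans n)"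
    using fans_restricted_separated[OF n U(1)] by blast
  then have "restriction S W \<in> TBP2"
    using iff[of U] \<open>finite U\<close> W(1) U restriction_triple_complex[OF \<open>W \<subseteq> f ` {..2 * n}\<close>, of N]
    by (auto simp: S_def)
  with W(4) show False ..
qed

end
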